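(* Let $\mathbf{X}$ be a Polish space, regarded as a represented space via the Cauchy representation with respect to a compatible complete metric and a countable dense sequence. Then $\mathbf{X}$ is $'$-overt if and only if $\mathbf{X}$ is $K_\sigma$ (i.e. a countable union of compact subsets).
   Context: A represented space is a pair $(X,\delta_X)$ with $\delta_X:\subseteq\mathbb{N}^\mathbb{N}\to X$ a partial surjection; a map between represented spaces is continuous (computable) if it has a continuous (computable) realizer on names. $\mathcal{C}(\mathbf{X},\mathbf{Y})$ is the represented space of continuous maps (standard exponential representation). Sierpiński space is $\mathbb{S}=(\{\bot,\top\},\delta_\mathbb{S})$ with $\delta_\mathbb{S}(0^\mathbb{N})=\bot$ and $\delta_\mathbb{S}(p)=\top$ for $p\neq 0^\mathbb{N}$. Let $\lim:\subseteq\mathbb{N}^\mathbb{N}\to\mathbb{N}^\mathbb{N}$ be $\lim(p)(n)=\lim_{i\to\infty}p(\langle n,i\rangle)$ (defined when all these limits exist), $\langle\cdot,\cdot\rangle$ a standard pairing. For a represented space $\mathbf{Y}=(Y,\delta_Y)$, $\mathbf{Y}'=(Y,\delta_Y\circ\lim)$. So $\mathbb{S}'=(\{\bot,\top\},\delta_\mathbb{S}\circ\lim)$, and $\mathcal{O}'(\mathbf{X}):=\mathcal{C}(\mathbf{X},\mathbb{S}')$, whose elements are identified with subsets of $X$ (the preimage of $\top$). $\mathbf{X}$ is $'$-overt if the map $\operatorname{IsNonEmpty}:\mathcal{O}'(\mathbf{X})\to\mathbb{S}'$, $U\mapsto\top$ iff $U\neq\emptyset$, is computable; for a Polish space without a fixed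 computability structure this is understood relative to an oracle, i.e. the map is continuous. *)

theory Defs
  imports "HOL-Analysis.Analysis" "HOL-Library.Countable" "HOL-Library.Nat_Bijection"
begin

text \<open>Baire space is nat => nat with the product topology (Function_Topology), where nat
  carries its discrete (metric) topology.  A representation of a set of points of type 'a
  is a partial map from Baire space, encoded as (nat => nat) => 'a option; its carrier is
  its range.\<close>

type_synonym baire = "nat \<Rightarrow> nat"
type_synonym 'a rep = "baire \<Rightarrow> 'a option"

definition rdom :: "'a rep \<Rightarrow> baire set" where
  "rdom d = {p. d p \<noteq> None}"

definition rep_continuous :: "'a rep \<Rightarrow> 'b rep \<Rightarrow> ('a \<Rightarrow> 'b) \<Rightarrow> bool" where
  "rep_continuous dA dB f \<longleftrightarrow>
     (\<exists>F :: baire \<Rightarrow> baire. continuous_on (rdom dA) F \<and>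
        (\<forall>p a. dA p = Some a \<longrightarrow> dB (F p) = Some (f a)))"

definition cauchy_rep :: "(nat \<Rightarrow> 'a::metric_space) \<Rightarrow> 'a rep" where
  "cauchy_rep s p =
     (if \<exists>x. \<forall>n. dist (s (p n)) x \<le> inverse (2 ^ n)
      then Some (THE x. \<forall>n. dist (s (p n)) x \<le> inverse (2 ^ n)) else None)"

definition baire_lim :: "baire \<Rightarrow> baire option" where
  "baire_lim p =
     (if \<forall>n. convergent (\<lambda>i. p (prod_encode (n, i)))
      then Some (\<lambda>n. lim (\<lambda>i. p (prod_encode (n, i)))) else None)"

text \<open>Sierpinski space: True = top, False = bottom; delta_S(0^N) = bottom.\<close>
definition sierp_rep :: "bool rep" where
  "sierp_rep p = Some (p \<noteq> (\<lambda>_. 0))"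

definition jump_rep :: "'a rep \<Rightarrow> 'a rep" where
  "jump_rep d p = (case baire_lim p of None \<Rightarrow> None | Some q \<Rightarrow> d q)"

text \<open>Standard (Kleene associate) encoding of continuous partial functions on Baire space:
  eta p q n = p(<n, code(q|k)>) - 1 for the least k with p(<n, code(q|k)>) > 0.\<close>
definition assoc_code :: "nat \<Rightarrow> baire \<Rightarrow> nat \<Rightarrow> nat" where
  "assoc_code n q k = prod_encode (n, to_nat (map q [0..<k]))"

definition eta :: "baire \<Rightarrow> baire \<Rightarrow> baire option" where
  "eta p q =
     (if \<forall>n. \<exists>k. p (assoc_code n q k) > 0
      then Some (\<lambda>n. p (assoc_code n q (LEAST k. p (assoc_code n q k) > 0)) - 1)
      else None)"

definition realizes_via :: "'a rep \<Rightarrow> 'b rep \<Rightarrow> baire \<Rightarrow> ('a \<Rightarrow> 'b) \<Rightarrow> bool" where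
  "realizes_via dX dY p f \<longleftrightarrow>
     (\<forall>q x. dX q = Some x \<longrightarrow> (\<exists>r. eta p q = Some r \<and> dY r = Some (f x)))"

definition fun_rep :: "'a rep \<Rightarrow> 'b rep \<Rightarrow> ('a \<Rightarrow> 'b) rep" where
  "fun_rep dX dY p =
     (if \<exists>f. realizes_via dX dY p f then Some (THE f. realizes_via dX dY p f) else None)"

definition open'_rep :: "'a rep \<Rightarrow> ('a \<Rightarrow> bool) rep" where
  "open'_rep dX = fun_rep dX (jump_rep sierp_rep)"

definition is_nonempty :: "('a \<Rightarrow> bool) \<Rightarrow> bool" where
  "is_nonempty U \<longleftrightarrow> (\<exists>x. U x)"

text \<open>'-overtness (relative to an oracle, i.e. continuity of IsNonEmpty).\<close>
definition jump_overt :: "'a rep \<Rightarrow> bool" where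
  "jump_overt dX \<longleftrightarrow> rep_continuous (open'_rep dX) (jump_rep sierp_rep) is_nonempty"

definition K_sigma :: "'a::topological_space set \<Rightarrow> bool" where
  "K_sigma S \<longleftrightarrow> (\<exists>K :: nat \<Rightarrow> 'a set. (\<forall>n. compact (K n)) \<and> (\<Union>n. K n) = S)"

end

theory Submission
  imports Defs
begin

text \<open>If the space is \<open>K\<^sub>\<sigma>\<close>, it is covered by countably many compact sets of names. A set in
  \<open>open'_rep\<close> is a countable union of sets that are closed on names, and emptiness of a closed
  subset of a compact set of names is recognised at a finite stage, because a compact set has only
  finitely many prefixes of each length.

  Conversely, let \<open>q\<close> enumerate basic balls and let \<open>A(q)\<close> be the complement of their union.
  A name of \<open>A(q)\<close> depends continuously on \<open>q\<close>, so by overtness \<open>{q. A(q) \<noteq> {}}\<close> is a union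
  of closed sets \<open>C m\<close>. For each point \<open>x\<close>, Baire category on the closed set
  \<open>{q. x \<in> A(q)}\<close> yields \<open>m\<close> and a finite word \<open>w\<close> such that every \<open>q\<close> in it that
  extends \<open>w\<close> lies in \<open>C m\<close>. For fixed \<open>m\<close> and \<open>w\<close> the set of these points is totally
  bounded: otherwise let \<open>q\<close> be \<open>w\<close> followed by all balls of one small radius around the dense
  sequence. Finitely many of these balls never cover the set, so each prefix of \<open>q\<close> extends to an
  element of \<open>C m\<close>, whence \<open>q \<in> C m\<close>, although \<open>A(q)\<close> is empty.\<close>

section \<open>Topology of Baire space in terms of finite prefixes\<close>

lemma open_baire_iff:
  fixes U :: "baire set"
  shows "open U \<longleftrightarrow> (\<forall>p\<in>U. \<exists>k. \<forall>p'. (\<forall>i<k. p' i = p i) \<longrightarrow> p' \<in> U)"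
proof
  assume U: "open U"
  show "\<forall>p\<in>U. \<exists>k. \<forall>p'. (\<forall>i<k. p' i = p i) \<longrightarrow> p' \<in> U"
  proof
    fix p assume "p \<in> U"
    with U obtain X :: "nat \<Rightarrow> nat set"
      where X: "p \<in> PiE UNIV X" "finite {i. X i \<noteq> UNIV}" "PiE UNIV X \<subseteq> U"
      using product_topology_open_contains_basis[of "\<lambda>i. euclidean" UNIV U p]
      by (auto simp: open_fun_def)
    then obtain k where k: "\<And>i. X i \<noteq> UNIV \<Longrightarrow> i < k"
      unfolding finite_nat_iff_bounded by blast
    have "p' \<in> U" if "\<forall>i<k. p' i = p i" for p'
    proof -
      have "p' i \<in> X i" for i
        using that k[of i] X(1) by (cases "i < k") (auto simp: PiE_iff)
      then show ?thesis using X(3) by (auto simp: PiE_iff)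
    qed
    then show "\<exists>k. \<forall>p'. (\<forall>i<k. p' i = p i) \<longrightarrow> p' \<in> U" by blast
  qed
next
  assume U: "\<forall>p\<in>U. \<exists>k. \<forall>p'. (\<forall>i<k. p' i = p i) \<longrightarrow> p' \<in> U"
  show "open U"
  proof (subst open_subopen, intro ballI)
    fix p assume "p \<in> U"
    with U obtain k where k: "\<forall>p'. (\<forall>i<k. p' i = p i) \<longrightarrow> p' \<in> U" by blast
    have "open {p'. \<forall>i\<in>{..<k}. p' (id i) \<in> {p i}}"
      by (rule product_topology_basis') (auto simp: open_discrete)
    then show "\<exists>T. open T \<and> p \<in> T \<and> T \<subseteq> U"
      using k by (intro exI[of _ "{p'. \<forall>i\<in>{..<k}. p' (id i) \<in> {p i}}"]) auto
  qed
qed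

lemma continuous_on_baire_iff:
  fixes F :: "baire \<Rightarrow> baire"
  shows "continuous_on S F \<longleftrightarrow>
    (\<forall>p\<in>S. \<forall>n. \<exists>k. \<forall>p'\<in>S. (\<forall>i<k. p' i = p i) \<longrightarrow> F p' n = F p n)"
proof
  assume F: "continuous_on S F"
  show "\<forall>p\<in>S. \<forall>n. \<exists>k. \<forall>p'\<in>S. (\<forall>i<k. p' i = p i) \<longrightarrow> F p' n = F p n"
  proof (intro ballI allI)
    fix p n assume p: "p \<in> S"
    have "open {r. r n = F p n}"
      by (auto simp: open_baire_iff intro!: exI[of _ "Suc n"])
    moreover have "F p \<in> {r. r n = F p n}" by simp
    ultimately have "\<exists>A. open A \<and> p \<in> A \<and> (\<forall>y\<in>S. y \<in> A \<longrightarrow> F y \<in> {r. r n = F p n})"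
      using F p unfolding continuous_on_topological by blast
    then obtain A where A: "open A" "p \<in> A" "\<And>y. y \<in> S \<Longrightarrow> y \<in> A \<Longrightarrow> F y n = F p n"
      by blast
    then obtain k where "\<forall>p'. (\<forall>i<k. p' i = p i) \<longrightarrow> p' \<in> A"
      using open_baire_iff[of A] by blast
    then show "\<exists>k. \<forall>p'\<in>S. (\<forall>i<k. p' i = p i) \<longrightarrow> F p' n = F p n"
      using A(3) by blast
  qed
next
  assume F: "\<forall>p\<in>S. \<forall>n. \<exists>k. \<forall>p'\<in>S. (\<forall>i<k. p' i = p i) \<longrightarrow> F p' n = F p n"
  show "continuous_on S F"
    unfolding continuous_on_topological
  proof (intro ballI allI impI)
    fix p B assume p: "p \<in> S" and B: "open B" "F p \<in> B"
    obtain m where m: "\<forall>r. (\<forall>i<m. r i = F p i) \<longrightarrow> r \<in> B"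
      using B open_baire_iff[of B] by blast
    from F p obtain k where k: "\<And>n p'. p' \<in> S \<Longrightarrow> (\<forall>i<k n. p' i = p i) \<Longrightarrow> F p' n = F p n"
      by metis
    \<comment> \<open>Only the coordinates below \<open>m\<close> matter for \<open>B\<close>, so
      the largest of their moduli suffices; the inserted \<open>0\<close> covers
      \<open>m = 0\<close>.\<close>
    define l where "l = Max (insert 0 (k ` {..<m}))"
    have l: "k n \<le> l" if "n < m" for n
      unfolding l_def using that by (intro Max_ge) auto
    let ?A = "{p'. \<forall>i<l. p' i = p i}"
    have "open ?A" by (auto simp: open_baire_iff intro!: exI[of _ l])
    moreover have "F y \<in> B" if "y \<in> S" "y \<in> ?A" for y
    proof -
      have "F y i = F p i" if "i < m" for i
        using k[OF \<open>y \<in> S\<close>, of i] \<open>y \<in> ?A\<close> l[OF that] by auto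
      then show ?thesis using m by blast
    qed
    ultimately show "\<exists>A. open A \<and> p \<in> A \<and> (\<forall>y\<in>S. y \<in> A \<longrightarrow> F y \<in> B)"
      by (intro exI[of _ ?A]) auto
  qed
qed

section \<open>Names in the jump of Sierpinski space and in function spaces\<close>

lemma jump_sierp_SomeD:
  assumes "jump_rep sierp_rep r = Some b"
  shows "b \<longleftrightarrow> (\<exists>j N. \<forall>i\<ge>N. r (prod_encode (j, i)) \<noteq> 0)"
proof -
  define u where "u n = lim (\<lambda>i. r (prod_encode (n, i)))" for n
  from assms have conv: "convergent (\<lambda>i. r (prod_encode (n, i)))" for n
    by (auto simp: jump_rep_def baire_lim_def split: if_splits)
  with assms have b: "b \<longleftrightarrow> u \<noteq> (\<lambda>_. 0)"
    by (auto simp: jump_rep_def baire_lim_def sierp_rep_def u_def[abs_def])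
  \<comment> \<open>As \<open>nat\<close> is discrete, a convergent row is eventually constant, so a
    nonzero limit amounts to being nonzero from some point on.\<close>
  have ev: "\<forall>\<^sub>F i in sequentially. r (prod_encode (n, i)) = u n" for n
    using conv[of n] unfolding u_def convergent_LIMSEQ_iff tendsto_discrete .
  have "u n \<noteq> 0 \<longleftrightarrow> (\<exists>N. \<forall>i\<ge>N. r (prod_encode (n, i)) \<noteq> 0)" for n
    using ev[of n] unfolding eventually_sequentially by (metis nle_le)
  then show ?thesis unfolding b by (auto simp: fun_eq_iff)
qed

text \<open>This builds names for truth values of exists-forall form. By monotonicity each row of
  bits drops from 1 to 0 at most once, hence converges.\<close>

lemma jump_sierp_of_bool:
  assumes "\<And>j i i'. i \<le> i' \<Longrightarrow> P j i' \<Longrightarrow> P j i"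
  shows "jump_rep sierp_rep (\<lambda>m. of_bool (P (fst (prod_decode m)) (snd (prod_decode m))))
    = Some (\<exists>j. \<forall>i. P j i)"
proof -
  let ?r = "\<lambda>m. of_bool (P (fst (prod_decode m)) (snd (prod_decode m))) :: nat"
  have "(\<lambda>i. of_bool (P j i)) \<longlonglongrightarrow> (of_bool (\<forall>i. P j i) :: nat)" for j
  proof (cases "\<forall>i. P j i")
    case False
    then obtain N where "\<not> P j N" by blast
    then have "\<forall>i\<ge>N. \<not> P j i" using assms by blast
    with False show ?thesis
      unfolding tendsto_discrete eventually_sequentially by auto
  qed simp
  then have lim: "(\<lambda>i. ?r (prod_encode (j, i))) \<longlonglongrightarrow> of_bool (\<forall>i. P j i)" for j
    by simp
  have "baire_lim ?r = Some (\<lambda>j. of_bool (\<forall>i. P j i))"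
    using lim unfolding baire_lim_def by (auto simp: convergent_def intro!: limI)
  then show ?thesis by (simp add: jump_rep_def sierp_rep_def fun_eq_iff)
qed

text \<open>Surjectivity of \<open>dX\<close> makes the \<open>THE\<close> in \<open>fun_rep\<close>
  unambiguous: every point has a name, at which two functions realized by the same \<open>p\<close>
  must agree.\<close>

lemma fun_rep_eq_Some_iff:
  assumes "\<And>x. \<exists>q. dX q = Some x"
  shows "fun_rep dX dY p = Some f \<longleftrightarrow> realizes_via dX dY p f"
proof -
  have uniq: "g = h" if "realizes_via dX dY p g" "realizes_via dX dY p h" for g h
  proof
    fix x
    from assms obtain q where "dX q = Some x" by blast
    then show "g x = h x" using that unfolding realizes_via_def by fastforce
  qed
  have "(THE g. realizes_via dX dY p g) = h" if "realizes_via dX dY p h" for h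
    using that uniq by blast
  then show ?thesis unfolding fun_rep_def by (auto; metis)
qed

section \<open>Overtness from a countable cover by compact sets of names\<close>

lemma compact_baire_finite_prefixes:
  fixes C :: "baire set"
  assumes "compact C"
  shows "finite ((\<lambda>q. map q [0..<k]) ` C)"
proof -
  have fin: "finite ((\<lambda>q. q i) ` C)" for i
  proof -
    \<comment> \<open>Coordinates are continuous into the discrete space \<open>nat\<close>, where
      compact sets are finite.\<close>
    have "compact ((\<lambda>q. q i) ` C)"
      using assms
      by (intro compact_continuous_image continuous_on_subset[OF continuous_on_product_coordinates]) auto
    then obtain D where "finite D" "(\<lambda>q. q i) ` C \<subseteq> (\<Union>n\<in>D. {n})"
      by (rule compactE_image[where C = UNIV and f = "\<lambda>n. {n}"]) (auto simp: open_discrete)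
    then show ?thesis by (auto intro: finite_subset)
  qed
  have "(\<lambda>q. map q [0..<k]) ` C \<subseteq> {xs. set xs \<subseteq> (\<Union>i<k. (\<lambda>q. q i) ` C) \<and> length xs = k}"
    by (force simp: image_iff)
  then show ?thesis
    by (rule finite_subset) (intro finite_lists_length_eq finite_UN_I fin finite_lessThan)
qed

text \<open>A point lies in the set named by \<open>p\<close> iff some row of outputs is nonzero
  from some threshold on. The index \<open>t\<close> ranges over compact sets, rows and thresholds.
  For fixed \<open>t\<close>, compactness makes "some name in \<open>C n\<close> passes all stages"
  equivalent to "each stage is passed by some name in \<open>C n\<close>", which has the
  exists-forall form once \<open>t\<close> is quantified.\<close>

lemma jump_overt_if_sigma_compact_names:
  fixes d :: "'a rep" and C :: "nat \<Rightarrow> baire set"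
  assumes comp: "\<And>n. compact (C n)"
    and names: "\<And>n. C n \<subseteq> rdom d"
    and cover: "\<And>x. \<exists>n. \<exists>q\<in>C n. d q = Some x"
  shows "jump_overt d"
proof -
  \<comment> \<open>An entry \<open>1\<close> of an associate encodes output \<open>0\<close>, and
    only the first nonzero entry counts. So \<open>D\<close> says that prefixes of length at most
    \<open>M\<close> reveal no zero of row \<open>j\<close> in the columns \<open>N\<close> to
    \<open>N+M\<close>.\<close>
  define D where "D p j N M q \<longleftrightarrow> (\<forall>i\<in>{N..N+M}. \<forall>k\<le>M. p (assoc_code (prod_encode (j, i)) q k) = 1 \<longrightarrow>
      (\<exists>k'<k. p (assoc_code (prod_encode (j, i)) q k') \<noteq> 0))" for p :: baire and j N M q
  define T where "T p t M \<longleftrightarrow> (case prod_decode t of (n, t') \<Rightarrow> case prod_decode t' of (j, N) \<Rightarrow>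
      \<exists>q\<in>C n. D p j N M q)" for p t M
  define F where "F p m = (of_bool (T p (fst (prod_decode m)) (snd (prod_decode m))) :: nat)" for p m
  have D_mono: "D p j N M q" if "M \<le> M'" "D p j N M' q" for p j N M M' q
    using that unfolding D_def by auto
  have T_mono: "T p t M" if "M \<le> M'" "T p t M'" for p t M M'
    using that(2) D_mono[OF that(1)] unfolding T_def by (fastforce split: prod.splits)
  have surj: "\<exists>q. d q = Some x" for x using cover by blast
  have dom: "\<exists>f. realizes_via d (jump_rep sierp_rep) p f \<and> open'_rep d p = Some f"
    if "p \<in> rdom (open'_rep d)" for p
    using that fun_rep_eq_Some_iff[OF surj, where dY = "jump_rep sierp_rep" and p = p]
    unfolding rdom_def open'_rep_def by auto
  have correct: "(\<exists>t. \<forall>M. T p t M) \<longleftrightarrow> is_nonempty f"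
    if f: "realizes_via d (jump_rep sierp_rep) p f" for p f
  proof
    assume "is_nonempty f"
    then obtain x where x: "f x" by (auto simp: is_nonempty_def)
    obtain n q where q: "q \<in> C n" "d q = Some x" using cover by blast
    with f have "\<exists>r. eta p q = Some r \<and> jump_rep sierp_rep r = Some (f x)"
      unfolding realizes_via_def by blast
    with x obtain r where r: "eta p q = Some r" "jump_rep sierp_rep r = Some True" by auto
    from jump_sierp_SomeD[OF r(2)] obtain j N where jN: "\<And>i. i \<ge> N \<Longrightarrow> r (prod_encode (j, i)) \<noteq> 0"
      by auto
    have r_eq: "r m = p (assoc_code m q (LEAST k. p (assoc_code m q k) > 0)) - 1" for m
      using r(1) by (auto simp: eta_def split: if_splits)
    have "D p j N M q" for M
      unfolding D_def
    proof (intro ballI allI impI, rule ccontr)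
      fix i k assume i: "i \<in> {N..N+M}" and k: "p (assoc_code (prod_encode (j, i)) q k) = 1"
        and no: "\<not> (\<exists>k'<k. p (assoc_code (prod_encode (j, i)) q k') \<noteq> 0)"
      have "(LEAST k. p (assoc_code (prod_encode (j, i)) q k) > 0) = k"
        using k no by (intro Least_equality) (auto simp: not_less[symmetric])
      with k have "r (prod_encode (j, i)) = 0" by (simp add: r_eq)
      with jN[of i] i show False by simp
    qed
    then have "T p (prod_encode (n, prod_encode (j, N))) M" for M
      using q(1) unfolding T_def by auto
    then show "\<exists>t. \<forall>M. T p t M" by blast
  next
    assume "\<exists>t. \<forall>M. T p t M"
    then obtain t where t: "\<And>M. T p t M" by blast
    obtain n t' where "prod_decode t = (n, t')" by fastforce
    moreover obtain j N where "prod_decode t' = (j, N)" by fastforce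
    ultimately have T: "\<exists>q\<in>C n. D p j N M q" for M
      using t[of M] by (simp add: T_def)
    \<comment> \<open>Stage \<open>M\<close> reads only the first \<open>M\<close> entries of
      \<open>q\<close>.\<close>
    have clo: "closed {q. D p j N M q}" for M
    proof -
      have "D p j N M q' \<longleftrightarrow> D p j N M q" if "\<forall>i<M. q' i = q i" for q q'
      proof -
        have "map q' [0..<k] = map q [0..<k]" if "k \<le> M" for k
          using \<open>\<forall>i<M. q' i = q i\<close> that by auto
        then have eq: "assoc_code m q' k = assoc_code m q k" if "k \<le> M" for k m
          using that by (simp add: assoc_code_def)
        have "(\<exists>k'<k. p (assoc_code m q' k') \<noteq> 0) \<longleftrightarrow> (\<exists>k'<k. p (assoc_code m q k') \<noteq> 0)"
          if "k \<le> M" for k m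
          by (intro ex_cong1 conj_cong refl) (use that in \<open>simp add: eq\<close>)
        then show ?thesis unfolding D_def by (simp add: eq)
      qed
      then have "open (- {q. D p j N M q})"
        unfolding open_baire_iff by (intro ballI exI[of _ M]) blast
      then show ?thesis by (simp add: closed_def)
    qed
    \<comment> \<open>Stages get stricter as \<open>M\<close> grows, so a name passing stage
      \<open>Max I\<close> passes every stage in \<open>I\<close>.\<close>
    have fip: "C n \<inter> (\<Inter>M\<in>I. {q. D p j N M q}) \<noteq> {}" if I: "finite I" "I \<subseteq> UNIV" for I
    proof -
      obtain q where "q \<in> C n" "D p j N (Max I) q" using T by blast
      then have "q \<in> C n \<inter> (\<Inter>M\<in>I. {q. D p j N M q})" using D_mono Max_ge[OF I(1)] by blast
      then show ?thesis by blast
    qed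
    have "C n \<inter> (\<Inter>M\<in>UNIV. {q. D p j N M q}) \<noteq> {}"
      by (rule compact_imp_fip_image[OF comp clo fip])
    then obtain q where q: "q \<in> C n" "\<And>M. D p j N M q" by blast
    then obtain x where "d q = Some x" using names by (force simp: rdom_def)
    with f obtain r where r: "eta p q = Some r" "jump_rep sierp_rep r = Some (f x)"
      unfolding realizes_via_def by blast
    have ex: "\<exists>k. p (assoc_code m q k) > 0"
      and r_eq: "r m = p (assoc_code m q (LEAST k. p (assoc_code m q k) > 0)) - 1" for m
      using r(1) by (auto simp: eta_def split: if_splits)
    have "r (prod_encode (j, i)) \<noteq> 0" if "i \<ge> N" for i
    proof
      assume 0: "r (prod_encode (j, i)) = 0"
      let ?k = "LEAST k. p (assoc_code (prod_encode (j, i)) q k) > 0"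
      have pos: "p (assoc_code (prod_encode (j, i)) q ?k) > 0" using ex by (rule LeastI_ex)
      with 0 have one: "p (assoc_code (prod_encode (j, i)) q ?k) = 1" by (simp add: r_eq)
      \<comment> \<open>A stage this large covers both column \<open>i\<close> and prefix length
        \<open>?k\<close>, where the zero output would be exposed.\<close>
      have i: "i \<in> {N..N + max ?k (i - N)}" and le: "?k \<le> max ?k (i - N)" using \<open>i \<ge> N\<close> by auto
      obtain k' where "k' < ?k" "p (assoc_code (prod_encode (j, i)) q k') \<noteq> 0"
        using q(2)[unfolded D_def, THEN bspec, OF i, THEN spec, THEN mp, OF le, THEN mp, OF one]
        by (elim exE conjE)
      then show False by (auto dest: not_less_Least)
    qed
    with jump_sierp_SomeD[OF r(2)] have "f x" by blast
    then show "is_nonempty f" by (auto simp: is_nonempty_def)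
  qed
  have "jump_rep sierp_rep (F p) = Some (is_nonempty f)" if "open'_rep d p = Some f" for p f
  proof -
    have "realizes_via d (jump_rep sierp_rep) p f"
      using that fun_rep_eq_Some_iff[OF surj] unfolding open'_rep_def by blast
    then show ?thesis
      using jump_sierp_of_bool[of "T p", OF T_mono] correct unfolding F_def[abs_def] by simp
  qed
  moreover have "continuous_on S F" for S
    unfolding continuous_on_baire_iff
  proof (intro ballI allI)
    fix p m
    obtain t M where m: "prod_decode m = (t, M)" by fastforce
    obtain n t' where t: "prod_decode t = (n, t')" by fastforce
    obtain j N where t': "prod_decode t' = (j, N)" by fastforce
    \<comment> \<open>These are the positions of \<open>p\<close> that stage \<open>M\<close>
      consults for names in \<open>C n\<close>. Their finiteness makes the search over all of
      \<open>C n\<close> continuous in \<open>p\<close>.\<close>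
    let ?A = "\<Union>i\<in>{N..N+M}. \<Union>k\<in>{..M}. (\<lambda>xs. prod_encode (prod_encode (j, i), to_nat xs)) ` (\<lambda>q. map q [0..<k]) ` C n"
    have "finite ?A"
      by (intro finite_UN_I finite_imageI compact_baire_finite_prefixes comp) auto
    then obtain b where b: "?A \<subseteq> {..<b}" unfolding finite_nat_iff_bounded by blast
    have "F p' m = F p m" if "\<forall>i<b. p' i = p i" for p'
    proof -
      have "p' (assoc_code (prod_encode (j, i)) q k) = p (assoc_code (prod_encode (j, i)) q k)"
        if "i \<in> {N..N+M}" "k \<le> M" "q \<in> C n" for i k q
      proof -
        have "assoc_code (prod_encode (j, i)) q k \<in> ?A"
          unfolding assoc_code_def using that by blast
        then show ?thesis using b \<open>\<forall>i<b. p' i = p i\<close> by blast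
      qed
      then have "D p' j N M q \<longleftrightarrow> D p j N M q" if "q \<in> C n" for q
        using that unfolding D_def by fastforce
      then show ?thesis unfolding F_def T_def m t t' by (auto simp: m t t')
    qed
    then show "\<exists>k. \<forall>p'\<in>S. (\<forall>i<k. p' i = p i) \<longrightarrow> F p' m = F p m" by blast
  qed
  ultimately show ?thesis
    unfolding jump_overt_def rep_continuous_def by blast
qed

section \<open>Cauchy names and compact sets\<close>

lemma cauchy_rep_eq_Some_iff:
  "cauchy_rep s q = Some x \<longleftrightarrow> (\<forall>n. dist (s (q n)) x \<le> inverse (2 ^ n))"
proof -
  have uniq: "x = y" if x: "\<forall>n. dist (s (q n)) x \<le> inverse (2 ^ n)"
    and y: "\<forall>n. dist (s (q n)) y \<le> inverse (2 ^ n)" for x y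
  proof (rule ccontr)
    assume "x \<noteq> y"
    then obtain n where n: "inverse (2 ^ n) < dist x y / 2"
      using real_arch_pow_inv[of "dist x y / 2" "1/2"] by (auto simp: power_one_over inverse_eq_divide)
    have "dist x y \<le> dist (s (q n)) x + dist (s (q n)) y" by (rule dist_triangle3)
    with x y n show False by (smt (verit) field_sum_of_halves)
  qed
  have "(THE y. \<forall>n. dist (s (q n)) y \<le> inverse (2 ^ n)) = x"
    if "\<forall>n. dist (s (q n)) x \<le> inverse (2 ^ n)" for x
    using that by (rule the_equality) (rule uniq[OF _ that])
  then show ?thesis unfolding cauchy_rep_def by (smt (verit, best) option.inject option.distinct(1))
qed

lemma dense_approx:
  fixes s :: "nat \<Rightarrow> 'a::metric_space"
  assumes "closure (range s) = UNIV" "0 < e"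
  obtains c where "dist (s c) x < e"
proof -
  have "x \<in> closure (range s)" using assms by simp
  then show ?thesis using assms(2) that unfolding closure_approachable by blast
qed

lemma cauchy_rep_surj:
  assumes "closure (range s) = UNIV"
  shows "\<exists>q. cauchy_rep s q = Some x"
proof -
  have "\<exists>c. dist (s c) x \<le> inverse (2 ^ n)" for n
    using dense_approx[OF assms, of "inverse (2 ^ n)" x] by (metis less_imp_le positive_imp_inverse_positive zero_less_numeral zero_less_power)
  then show ?thesis unfolding cauchy_rep_eq_Some_iff by metis
qed

lemma compact_PiE_finite:
  fixes G :: "nat \<Rightarrow> nat set"
  assumes "\<And>n. finite (G n)"
  shows "compact {q. \<forall>n. q n \<in> G n}"
proof -
  have "compactin (product_topology (\<lambda>_. euclidean) UNIV) (PiE UNIV G)"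
    using assms by (subst compactin_PiE) (auto intro: finite_imp_compact)
  then show ?thesis by (simp add: euclidean_product_topology PiE_def Pi_def)
qed

text \<open>Sequences with entries from finite nets \<open>G n\<close> form a compact set. Pairing
  them with the points of \<open>K\<close> that they name gives a closed subset of a compact
  product, and its projection to names is the required set.\<close>

lemma compact_has_compact_names:
  fixes s :: "nat \<Rightarrow> 'a::metric_space"
  assumes dense: "closure (range s) = UNIV" and K: "compact K"
  obtains C where "compact C" "C \<subseteq> rdom (cauchy_rep s)" "\<And>x. x \<in> K \<Longrightarrow> \<exists>q\<in>C. cauchy_rep s q = Some x"
proof -
  have "\<exists>G. finite G \<and> (\<forall>x\<in>K. \<exists>c\<in>G. dist (s c) x \<le> inverse (2 ^ n))" for n
  proof -
    have "K \<subseteq> (\<Union>c\<in>UNIV. ball (s c) (inverse (2 ^ n)))"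
    proof
      fix x
      obtain c where "dist (s c) x < inverse (2 ^ n)"
        by (rule dense_approx[OF dense, of "inverse (2 ^ n)" x]) auto
      then show "x \<in> (\<Union>c\<in>UNIV. ball (s c) (inverse (2 ^ n)))" by auto
    qed
    then obtain G where "finite G" "K \<subseteq> (\<Union>c\<in>G. ball (s c) (inverse (2 ^ n)))"
      using compactE_image[OF K, of UNIV "\<lambda>c. ball (s c) (inverse (2 ^ n))"] by auto
    then show ?thesis by (intro exI[of _ G]) (auto 4 4 intro: less_imp_le)
  qed
  then obtain G where G: "\<And>n. finite (G n)" "\<And>n x. x \<in> K \<Longrightarrow> \<exists>c\<in>G n. dist (s c) x \<le> inverse (2 ^ n)"
    by metis
  define R where "R = ({q. \<forall>n. q n \<in> G n} \<times> K) \<inter> (\<Inter>n. {(q, x). dist (s (q n)) x \<le> inverse (2 ^ n)})"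
  have "closed {(q, x). dist (s (q n)) x \<le> inverse (2 ^ n)}" for n
  proof -
    have "continuous_on UNIV (\<lambda>z :: baire \<times> 'a. (fst z) n)"
      by (rule continuous_on_compose2[OF continuous_on_product_coordinates continuous_on_fst[OF continuous_on_id]]) auto
    \<comment> \<open>Any \<open>s\<close> is continuous, as its domain \<open>nat\<close> is
      discrete.\<close>
    then have "continuous_on UNIV (\<lambda>z :: baire \<times> 'a. s (fst z n))"
      by (rule continuous_on_compose2[of UNIV s, rotated]) auto
    then show ?thesis
      unfolding case_prod_unfold by (intro closed_Collect_le continuous_intros)
  qed
  then have "compact R"
    unfolding R_def by (intro compact_Int_closed compact_Times compact_PiE_finite G K closed_INT ballI)
  then have "compact (fst ` R)"
    by (intro compact_continuous_image continuous_intros)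
  moreover have "fst ` R \<subseteq> rdom (cauchy_rep s)"
    using cauchy_rep_eq_Some_iff[of s] by (fastforce simp: rdom_def R_def)
  moreover have "\<exists>q\<in>fst ` R. cauchy_rep s q = Some x" if x: "x \<in> K" for x
  proof -
    obtain q where "\<And>n. q n \<in> G n" "\<And>n. dist (s (q n)) x \<le> inverse (2 ^ n)"
      using G(2)[OF x] by metis
    then show ?thesis
      using x by (intro bexI[of _ q]) (auto simp: cauchy_rep_eq_Some_iff R_def intro!: image_eqI[of _ _ "(q, x)"])
  qed
  ultimately show ?thesis using that by blast
qed

lemma K_sigma_imp_jump_overt:
  fixes s :: "nat \<Rightarrow> 'a::metric_space"
  assumes dense: "closure (range s) = UNIV" and "K_sigma (UNIV :: 'a set)"
  shows "jump_overt (cauchy_rep s)"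
proof -
  obtain K :: "nat \<Rightarrow> 'a set" where K: "\<And>n. compact (K n)" "(\<Union>n. K n) = UNIV"
    using assms(2) unfolding K_sigma_def by blast
  have "\<exists>C. compact C \<and> C \<subseteq> rdom (cauchy_rep s) \<and> (\<forall>x\<in>K n. \<exists>q\<in>C. cauchy_rep s q = Some x)" for n
    by (rule compact_has_compact_names[OF dense K(1)[of n]]) blast
  then obtain C where "\<And>n. compact (C n)" "\<And>n. C n \<subseteq> rdom (cauchy_rep s)"
    "\<And>n x. x \<in> K n \<Longrightarrow> \<exists>q\<in>C n. cauchy_rep s q = Some x"
    by metis
  then show ?thesis
    using K(2) by (intro jump_overt_if_sigma_compact_names[of C]) (auto, blast)
qed

section \<open>Complements of enumerated unions of basic balls\<close>

text \<open>Code \<open>0\<close> for the empty ball lets an enumeration pause: a finite list of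
  codes can be continued by zeros without covering further points.\<close>

definition basic_ball :: "(nat \<Rightarrow> 'a::metric_space) \<Rightarrow> nat \<Rightarrow> 'a set" where
  "basic_ball s e = (case e of 0 \<Rightarrow> {} | Suc e' \<Rightarrow>
    (case prod_decode e' of (c, t) \<Rightarrow> ball (s c) (inverse (2 ^ t))))"

text \<open>The family is indexed by the point because the category argument fixes \<open>x\<close>
  and varies \<open>q\<close>; the set A(q) of the overview is
  \<open>{x. q \<in> avoiding s x}\<close>.\<close>

definition avoiding :: "(nat \<Rightarrow> 'a::metric_space) \<Rightarrow> 'a \<Rightarrow> baire set" where
  "avoiding s x = {q. \<forall>i. x \<notin> basic_ball s (q i)}"

lemma basic_ball_simps [simp]:
  "basic_ball s 0 = {}"
  "basic_ball s (Suc (prod_encode (c, t))) = ball (s c) (inverse (2 ^ t))"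
  by (simp_all add: basic_ball_def)

text \<open>Entry \<open>c\<close> at position \<open>m\<close> of a name confines the point to this
  closed ball, so the inclusion certifies membership from finite information. It may be undecidable,
  but only continuity is at stake.\<close>

definition ball_witness :: "(nat \<Rightarrow> 'a::metric_space) \<Rightarrow> nat \<Rightarrow> nat \<Rightarrow> nat \<Rightarrow> bool" where
  "ball_witness s e c m \<longleftrightarrow> cball (s c) (inverse (2 ^ m)) \<subseteq> basic_ball s e"

text \<open>Certificates are sound because the bound on names is non-strict, matching
  \<open>cball\<close>. One is eventually found because basic balls are open: if
  \<open>ball x r\<close> fits inside, so does the closed ball at any \<open>m\<close> with
  \<open>inverse (2 ^ m) < r / 2\<close>.\<close>

lemma ball_witness_iff:
  assumes q: "cauchy_rep s y = Some x"
  shows "x \<in> basic_ball s e \<longleftrightarrow> (\<exists>m. ball_witness s e (y m) m)"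
proof
  assume "x \<in> basic_ball s e"
  moreover have "open (basic_ball s e)" by (auto simp: basic_ball_def split: nat.split prod.split)
  ultimately obtain r where r: "r > 0" "ball x r \<subseteq> basic_ball s e"
    unfolding open_contains_ball by blast
  obtain m where m: "inverse (2 ^ m) < r / 2"
    using real_arch_pow_inv[of "r / 2" "1/2"] r by (auto simp: power_one_over inverse_eq_divide)
  have "z \<in> ball x r" if "z \<in> cball (s (y m)) (inverse (2 ^ m))" for z
  proof -
    have "dist x z \<le> dist (s (y m)) x + dist (s (y m)) z" by (rule dist_triangle3)
    moreover have "dist (s (y m)) x \<le> inverse (2 ^ m)" using q cauchy_rep_eq_Some_iff by blast
    ultimately show ?thesis using m that unfolding mem_ball mem_cball by linarith
  qed
  then show "\<exists>m. ball_witness s e (y m) m" using r unfolding ball_witness_def by blast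
next
  assume "\<exists>m. ball_witness s e (y m) m"
  then show "x \<in> basic_ball s e"
    using q unfolding ball_witness_def cauchy_rep_eq_Some_iff by (meson mem_cball subsetD)
qed

text \<open>An associate of the characteristic function of the complement of all \<open>basic_ball s (q l)\<close>.
  Its output at the pair \<open>(j, i)\<close> is \<open>1\<close> unless one of the first \<open>i\<close> balls is seen to
  contain the point by inspecting the first \<open>i\<close> entries of its name; an associate stores
  outputs shifted by one, hence the summand \<open>1\<close>.\<close>
definition avoid_name :: "(nat \<Rightarrow> 'a::metric_space) \<Rightarrow> baire \<Rightarrow> baire" where
  "avoid_name s q = (\<lambda>a. case prod_decode a of (n, w) \<Rightarrow>
     (let i = snd (prod_decode n); ys = (from_nat w :: nat list) in
      if length ys = i then 1 + of_bool (\<forall>l<i. \<forall>m<i. \<not> ball_witness s (q l) (ys ! m) m) else 0))"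

lemma avoid_name_code:
  "avoid_name s q (assoc_code n y k) =
    (if k = snd (prod_decode n) then 1 + of_bool (\<forall>l<k. \<forall>m<k. \<not> ball_witness s (q l) (y m) m) else 0)"
  by (auto simp: avoid_name_def assoc_code_def Let_def)

text \<open>The associate answers only at prefix length \<open>i\<close>, so the least answering
  length is \<open>i\<close>. Detection is permanent: the outputs drop to \<open>0\<close> for good
  if some ball contains the point, and stay \<open>1\<close> otherwise.\<close>

lemma realizes_avoid_name:
  "realizes_via (cauchy_rep s) (jump_rep sierp_rep) (avoid_name s q) (\<lambda>x. q \<in> avoiding s x)"
  unfolding realizes_via_def
proof (intro allI impI)
  fix y x assume y: "cauchy_rep s y = Some x"
  \<comment> \<open>All rows \<open>j\<close> carry the same sequence, so the existential over rows
    has no effect.\<close>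
  define P where "P j i \<longleftrightarrow> (\<forall>l<i. \<forall>m<i. \<not> ball_witness s (q l) (y m) m)" for j i :: nat
  let ?r = "\<lambda>m. of_bool (P (fst (prod_decode m)) (snd (prod_decode m))) :: nat"
  have pos: "avoid_name s q (assoc_code n y k) > 0 \<longleftrightarrow> k = snd (prod_decode n)" for n k
    by (simp add: avoid_name_code)
  have "(LEAST k. avoid_name s q (assoc_code n y k) > 0) = snd (prod_decode n)" for n
    unfolding pos by (rule Least_equality) auto
  then have eta: "eta (avoid_name s q) y = Some ?r"
    unfolding eta_def pos by (auto simp: avoid_name_code P_def)
  have "(\<exists>j. \<forall>i. P j i) \<longleftrightarrow> (\<forall>l m. \<not> ball_witness s (q l) (y m) m)"
  proof
    assume "\<exists>j. \<forall>i. P j i"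
    then have P: "P j i" for j i by (simp add: P_def)
    show "\<forall>l m. \<not> ball_witness s (q l) (y m) m"
    proof (intro allI)
      fix l m
      show "\<not> ball_witness s (q l) (y m) m" using P[of 0 "Suc (l + m)"] by (simp add: P_def)
    qed
  qed (simp add: P_def)
  also have "\<dots> \<longleftrightarrow> q \<in> avoiding s x"
    using ball_witness_iff[OF y] by (auto simp: avoiding_def)
  finally have "jump_rep sierp_rep ?r = Some (q \<in> avoiding s x)"
    using jump_sierp_of_bool[of P] unfolding P_def by auto
  with eta show "\<exists>r. eta (avoid_name s q) y = Some r \<and> jump_rep sierp_rep r = Some (q \<in> avoiding s x)"
    by blast
qed

lemma continuous_on_avoid_name: "continuous_on S (avoid_name s)"
  unfolding continuous_on_baire_iff
proof (intro ballI allI)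
  fix q a
  show "\<exists>k. \<forall>q'\<in>S. (\<forall>i<k. q' i = q i) \<longrightarrow> avoid_name s q' a = avoid_name s q a"
    by (intro exI[of _ "snd (prod_decode (fst (prod_decode a)))"])
      (auto simp: avoid_name_def Let_def split: prod.split)
qed

section \<open>Baire category and the closed sets obtained from overtness\<close>

text \<open>If every cylinder around a point of \<open>P\<close> contained points of
  \<open>P\<close> outside each \<open>C m\<close>, prefixes could be extended successively within
  \<open>P\<close> so as to leave \<open>C 0\<close>, \<open>C 1\<close>, and so on for good. The
  limit would lie in the closed set \<open>P\<close> but in no \<open>C m\<close>.\<close>

lemma baire_category_cylinder:
  fixes P :: "baire set" and C :: "nat \<Rightarrow> baire set"
  assumes P: "closed P" "P \<noteq> {}" and C: "\<And>m. closed (C m)" and cover: "P \<subseteq> (\<Union>m. C m)"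
  obtains (cylinder) m k q where "q \<in> P" "\<And>q'. q' \<in> P \<Longrightarrow> (\<forall>i<k. q' i = q i) \<Longrightarrow> q' \<in> C m"
proof (rule ccontr)
  assume contra: "\<not> thesis"
  have no: "\<exists>q'. q' \<in> P \<and> (\<forall>i<k. q' i = q i) \<and> q' \<notin> C m" if "q \<in> P" for q m k
    using contra cylinder[OF that, of k m] by blast
  \<comment> \<open>A state is a point of \<open>P\<close> with the length of the prefix committed
    so far. As \<open>C m\<close> is closed, a long enough prefix already forces every extension out
    of it.\<close>
  have step: "\<exists>z'. fst z' \<in> P \<and> snd z < snd z' \<and> (\<forall>i<snd z. fst z' i = fst z i)
      \<and> (\<forall>r. (\<forall>i<snd z'. r i = fst z' i) \<longrightarrow> r \<notin> C m)" if z: "fst z \<in> P" for z :: "baire \<times> nat" and m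
  proof -
    obtain q' where q': "q' \<in> P" "\<forall>i<snd z. q' i = fst z i" "q' \<in> - C m" using no[OF z] by blast
    moreover have "open (- C m)" using C by (simp add: open_Compl)
    ultimately obtain k where k: "\<forall>r. (\<forall>i<k. r i = q' i) \<longrightarrow> r \<in> - C m"
      unfolding open_baire_iff by blast
    show ?thesis
      using q' k by (intro exI[of _ "(q', max k (Suc (snd z)))"]) auto
  qed
  obtain q0 where "q0 \<in> P" using P by blast
  then have "\<exists>f. \<forall>n. fst (f n) \<in> P \<and> (snd (f n) < snd (f (Suc n)) \<and> (\<forall>i<snd (f n). fst (f (Suc n)) i = fst (f n) i)
      \<and> (\<forall>r. (\<forall>i<snd (f (Suc n)). r i = fst (f (Suc n)) i) \<longrightarrow> r \<notin> C n))"
    using step by (intro dependent_nat_choice[where P = "\<lambda>_ z. fst z \<in> P"]) (auto intro: exI[of _ "(q0, 0)"])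
  then obtain f :: "nat \<Rightarrow> baire \<times> nat" where f: "\<And>n. fst (f n) \<in> P" "\<And>n. snd (f n) < snd (f (Suc n))"
    "\<And>n i. i < snd (f n) \<Longrightarrow> fst (f (Suc n)) i = fst (f n) i"
    "\<And>n r. (\<forall>i<snd (f (Suc n)). r i = fst (f (Suc n)) i) \<Longrightarrow> r \<notin> C n"
    by blast
  have sm: "strict_mono (\<lambda>n. snd (f n))" using f(2) by (simp add: strict_mono_Suc_iff)
  have stable: "fst (f (n + d)) i = fst (f n) i" if "i < snd (f n)" for n d i
  proof (induction d)
    case (Suc d)
    have "snd (f n) \<le> snd (f (n + d))" using sm[THEN strict_mono_less_eq] by simp
    then show ?case using f(3)[of i "n + d"] that Suc by simp
  qed simp
  have len: "n \<le> snd (f n)" for n using sm by (rule strict_mono_imp_increasing)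
  \<comment> \<open>Coordinate \<open>i\<close> is settled at stage \<open>Suc i\<close>, when the
    committed prefix is longer than \<open>i\<close>.\<close>
  define r where "r i = fst (f (Suc i)) i" for i
  have r: "r i = fst (f n) i" if "i < snd (f n)" for n i
  proof (cases "n \<le> Suc i")
    case True
    then show ?thesis using stable[OF that, of "Suc i - n"] by (simp add: r_def)
  next
    case False
    then show ?thesis using stable[of i "Suc i" "n - Suc i"] len[of "Suc i"] by (simp add: r_def)
  qed
  have "r \<notin> C n" for n using r f(4) by blast
  moreover have "r \<in> P"
  proof (rule ccontr)
    assume "r \<notin> P"
    moreover have "open (- P)" using P by (simp add: open_Compl)
    ultimately obtain k where k: "\<forall>r'. (\<forall>i<k. r' i = r i) \<longrightarrow> r' \<in> - P"
      unfolding open_baire_iff by blast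
    have "\<forall>i<k. fst (f k) i = r i" using r[of _ k] len[of k] by (simp add: less_le_trans)
    then show False using k f(1) by blast
  qed
  ultimately show False using cover by blast
qed

lemma closed_avoiding: "closed (avoiding s x)"
proof -
  have "\<exists>k. \<forall>q'. (\<forall>i<k. q' i = q i) \<longrightarrow> q' \<in> - avoiding s x" if q: "q \<in> - avoiding s x" for q
  proof -
    obtain i where "x \<in> basic_ball s (q i)" using q by (auto simp: avoiding_def)
    then have "q' \<in> - avoiding s x" if "\<forall>l<Suc i. q' l = q l" for q'
      using that by (auto simp: avoiding_def intro!: exI[of _ i])
    then show ?thesis by blast
  qed
  then have "open (- avoiding s x)" unfolding open_baire_iff by blast
  then show ?thesis by (simp add: closed_def)
qed

text \<open>Feeding \<open>avoid_name\<close> to a realizer of \<open>is_nonempty\<close> gives a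
  continuous total map \<open>H\<close>. Each index \<open>m\<close> encodes a row and a threshold,
  and requiring nonzero outputs of \<open>H q\<close> from there on is an intersection of closed
  conditions on \<open>q\<close>.\<close>

lemma jump_overt_avoiding_F_sigma:
  assumes dense: "closure (range s) = UNIV" and overt: "jump_overt (cauchy_rep s)"
  obtains C where "\<And>m :: nat. closed (C m)" "{q. \<exists>x. q \<in> avoiding s x} = (\<Union>m. C m)"
proof -
  obtain F where F: "continuous_on (rdom (open'_rep (cauchy_rep s))) F"
    and real: "\<And>p f. open'_rep (cauchy_rep s) p = Some f \<Longrightarrow> jump_rep sierp_rep (F p) = Some (is_nonempty f)"
    using overt unfolding jump_overt_def rep_continuous_def by blast
  have name: "open'_rep (cauchy_rep s) (avoid_name s q) = Some (\<lambda>x. q \<in> avoiding s x)" for q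
    unfolding open'_rep_def
    using fun_rep_eq_Some_iff[OF cauchy_rep_surj[OF dense]] realizes_avoid_name by blast
  define H where "H q = F (avoid_name s q)" for q
  have "continuous_on UNIV H"
    unfolding H_def
    by (rule continuous_on_compose2[OF F continuous_on_avoid_name]) (auto simp: rdom_def name)
  then have cont: "continuous_on UNIV (\<lambda>q. H q n)" for n
    by (rule continuous_on_product_then_coordinatewise)
  define C where "C m = (\<Inter>i\<in>{snd (prod_decode m)..}. {q. H q (prod_encode (fst (prod_decode m), i)) \<noteq> 0})" for m
  have "closed (C m)" for m
    unfolding C_def
  proof (intro closed_INT ballI)
    fix i
    have "closed ({0<..} :: nat set)" by (simp add: closed_def open_discrete)
    then have "closed ((\<lambda>q. H q (prod_encode (fst (prod_decode m), i))) -` {0<..})"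
      using cont by (rule closed_vimage)
    then show "closed {q. H q (prod_encode (fst (prod_decode m), i)) \<noteq> 0}"
      by (simp add: vimage_def)
  qed
  moreover have "(\<exists>x. q \<in> avoiding s x) \<longleftrightarrow> q \<in> (\<Union>m. C m)" for q
  proof -
    have "(\<exists>x. q \<in> avoiding s x) \<longleftrightarrow> (\<exists>j N. \<forall>i\<ge>N. H q (prod_encode (j, i)) \<noteq> 0)"
      using jump_sierp_SomeD[OF real[OF name]] unfolding is_nonempty_def H_def .
    also have "\<dots> \<longleftrightarrow> q \<in> (\<Union>m. C m)"
    proof
      assume "\<exists>j N. \<forall>i\<ge>N. H q (prod_encode (j, i)) \<noteq> 0"
      then obtain j N where "\<forall>i\<ge>N. H q (prod_encode (j, i)) \<noteq> 0" by blast
      then have "q \<in> C (prod_encode (j, N))" by (simp add: C_def)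
      then show "q \<in> (\<Union>m. C m)" by blast
    next
      assume "q \<in> (\<Union>m. C m)"
      then obtain m where "q \<in> C m" by blast
      then have "\<forall>i\<ge>snd (prod_decode m). H q (prod_encode (fst (prod_decode m), i)) \<noteq> 0"
        by (simp add: C_def)
      then show "\<exists>j N. \<forall>i\<ge>N. H q (prod_encode (j, i)) \<noteq> 0" by blast
    qed
    finally show ?thesis .
  qed
  then have "{q. \<exists>x. q \<in> avoiding s x} = (\<Union>m. C m)" by (intro set_eqI) simp
  ultimately show ?thesis by (rule that)
qed

section \<open>Total boundedness and the countable compact cover\<close>

lemma compact_closure_if_finitely_covered:
  fixes X :: "'a::complete_space set" and s :: "nat \<Rightarrow> 'a"
  assumes "\<And>t. \<exists>k. X \<subseteq> (\<Union>i<k. ball (s i) (inverse (2 ^ t)))"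
  shows "compact (closure X)"
  unfolding compact_eq_totally_bounded
proof (intro conjI allI impI)
  show "complete (closure X)" by (simp add: complete_eq_closed)
  fix e :: real assume "e > 0"
  then obtain t where t: "inverse (2 ^ t) < e"
    using real_arch_pow_inv[of e "1/2"] by (auto simp: power_one_over inverse_eq_divide)
  obtain k where "X \<subseteq> (\<Union>i<k. ball (s i) (inverse (2 ^ t)))" using assms by blast
  \<comment> \<open>A finite union of closed balls is closed and so covers the closure too; the
    strict bound on the radius leads back to open balls.\<close>
  then have "X \<subseteq> (\<Union>i<k. cball (s i) (inverse (2 ^ t)))"
    by (rule order_trans) (intro UN_mono ball_subset_cball subset_refl)
  then have "closure X \<subseteq> (\<Union>i<k. cball (s i) (inverse (2 ^ t)))"
    by (rule closure_minimal) (auto intro!: closed_UN)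
  also have "\<dots> \<subseteq> (\<Union>c\<in>s ` {..<k}. ball c e)" using t by fastforce
  finally show "\<exists>k. finite k \<and> closure X \<subseteq> (\<Union>x\<in>k. ball x e)" by blast
qed

lemma finitely_covered_if_cylinder_in_closed:
  fixes s :: "nat \<Rightarrow> 'a::metric_space"
  assumes dense: "closure (range s) = UNIV" and C: "closed C" "C \<subseteq> {q. \<exists>x. q \<in> avoiding s x}"
    and w: "\<And>x e. x \<in> X \<Longrightarrow> e \<in> set w \<Longrightarrow> x \<notin> basic_ball s e"
    and X: "\<And>x q. x \<in> X \<Longrightarrow> q \<in> avoiding s x \<Longrightarrow> map q [0..<length w] = w \<Longrightarrow> q \<in> C"
  shows "\<exists>k. X \<subseteq> (\<Union>i<k. ball (s i) (inverse (2 ^ t)))"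
proof (rule ccontr)
  assume no: "\<not> ?thesis"
  \<comment> \<open>After \<open>w\<close>, the ball around \<open>s c\<close> stands at position
    \<open>length w + c\<close>, so \<open>q\<close> covers the whole space.\<close>
  define q where "q i = (if i < length w then w ! i else Suc (prod_encode (i - length w, t)))" for i
  have "q \<in> C"
  proof (rule ccontr)
    assume "q \<notin> C"
    then have "q \<in> - C" by simp
    moreover have "open (- C)" using C by (simp add: open_Compl)
    ultimately obtain k where k: "\<forall>r. (\<forall>i<k. r i = q i) \<longrightarrow> r \<in> - C"
      unfolding open_baire_iff by blast
    \<comment> \<open>Past \<open>w\<close>, a position \<open>i < k\<close> has centre index
      \<open>i - length w\<close>, which is below \<open>k\<close>; hence \<open>x\<close> avoids
      every ball listed by \<open>q\<close> before \<open>k\<close>.\<close>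
    obtain x where x: "x \<in> X" "x \<notin> (\<Union>i<k. ball (s i) (inverse (2 ^ t)))" using no by blast
    \<comment> \<open>The prefix of \<open>q\<close> is completed with empty balls, so that
      \<open>r\<close> still avoids \<open>x\<close>.\<close>
    define r where "r i = (if i < length w \<or> i < k then q i else 0)" for i
    have "x \<notin> basic_ball s (r i)" for i
      using x w[OF x(1), of "w ! i"] by (auto simp: r_def q_def)
    then have "r \<in> avoiding s x" by (simp add: avoiding_def)
    moreover have "map r [0..<length w] = w" by (auto simp: r_def q_def intro: nth_equalityI)
    ultimately have "r \<in> C" using X x by blast
    moreover have "\<forall>i<k. r i = q i" by (simp add: r_def)
    ultimately show False using k by blast
  qed
  then obtain x where x: "q \<in> avoiding s x" using C by blast
  obtain c where "dist (s c) x < inverse (2 ^ t)"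
    by (rule dense_approx[OF dense, of "inverse (2 ^ t)" x]) auto
  then have "x \<in> basic_ball s (q (length w + c))" by (simp add: q_def)
  with x show False by (auto simp: avoiding_def)
qed

lemma jump_overt_imp_K_sigma:
  fixes s :: "nat \<Rightarrow> 'a::complete_space"
  assumes dense: "closure (range s) = UNIV" and overt: "jump_overt (cauchy_rep s)"
  shows "K_sigma (UNIV :: 'a set)"
proof -
  obtain C where C: "\<And>m :: nat. closed (C m)" "{q. \<exists>x. q \<in> avoiding s x} = (\<Union>m. C m)"
    using jump_overt_avoiding_F_sigma[OF assms] by blast
  \<comment> \<open>The first clause excludes words that already cover \<open>x\<close>: no
    \<open>q\<close> avoiding \<open>x\<close> extends them, so the second clause would hold
    vacuously.\<close>
  define X where "X m w = {x. (\<forall>e\<in>set w. x \<notin> basic_ball s e) \<and>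
    (\<forall>q\<in>avoiding s x. map q [0..<length w] = w \<longrightarrow> q \<in> C m)}" for m w
  have "compact (closure (X m w))" for m w
  proof (rule compact_closure_if_finitely_covered)
    show "\<exists>k. X m w \<subseteq> (\<Union>i<k. ball (s i) (inverse (2 ^ t)))" for t
      by (rule finitely_covered_if_cylinder_in_closed[OF dense C(1)[of m], of _ w]) (use C(2) in \<open>auto simp: X_def\<close>)
  qed
  \<comment> \<open>Pairs of an index and a word are countable, which turns the family into a
    sequence.\<close>
  then have K: "compact (case from_nat n of (m :: nat, w :: nat list) \<Rightarrow> closure (X m w))" for n
    by (simp split: prod.split)
  have "\<exists>m w. x \<in> X m w" for x
  proof -
    have "(\<lambda>_. 0) \<in> avoiding s x" by (simp add: avoiding_def)
    then have ne: "avoiding s x \<noteq> {}" by blast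
    have cover: "avoiding s x \<subseteq> (\<Union>m. C m)" using C(2) by blast
    obtain m k q where q: "q \<in> avoiding s x"
      "\<And>q'. q' \<in> avoiding s x \<Longrightarrow> (\<forall>i<k. q' i = q i) \<Longrightarrow> q' \<in> C m"
      by (rule baire_category_cylinder[OF closed_avoiding ne C(1) cover]) blast
    have "x \<in> X m (map q [0..<k])"
      using q by (auto simp: X_def avoiding_def)
    then show ?thesis by blast
  qed
  then have "\<exists>n. x \<in> (case from_nat n of (m :: nat, w :: nat list) \<Rightarrow> closure (X m w))" for x
    by (metis (no_types, lifting) closure_subset from_nat_to_nat prod.case subsetD)
  then have "(\<Union>n. case from_nat n of (m :: nat, w :: nat list) \<Rightarrow> closure (X m w)) = UNIV"
    by (intro equalityI subset_UNIV) (rule subsetI, simp)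
  with K show ?thesis
    unfolding K_sigma_def by (intro exI conjI allI)
qed

theorem theorem36:
  fixes s :: "nat \<Rightarrow> 'a::polish_space"
  assumes "closure (range s) = UNIV"
  shows "jump_overt (cauchy_rep s) \<longleftrightarrow> K_sigma (UNIV :: 'a set)"
  using assms jump_overt_imp_K_sigma K_sigma_imp_jump_overt by blast

end
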